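(* Let $t(x)\in\mathbb{R}[x]$ be a fixed polynomial. Then for every interval $[a,b]\subset\mathbb{R}$ (with $a<b$) there exists a constant $C=C(a,b)$ (depending only on $a$, $b$ and the fixed polynomial $t$) such that $$\max_{x\in[a,b]}\left|\frac{d}{dx}P(x,e^{t(x)})\right|\le C\,(\deg P)^4\max_{x\in[a,b]}|P(x,e^{t(x)})|$$ for all bivariate polynomials $P(x,y)\in\mathbb{R}[x,y]$.
   Context: $\deg P$ denotes the total degree of the bivariate polynomial $P$. For constant $P$ both sides are zero, with the convention that $\deg 0=0$. *)

theory Defs
  imports "HOL-Analysis.Analysis" "HOL-Computational_Algebra.Polynomial"
begin

text \<open>
  Bivariate polynomials are elements of \<open>\<real>[x][y]\<close>, i.e. of type \<^typ>\<open>real poly poly\<close>: the outer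
  variable is \<open>y\<close>, and the coefficient of \<open>x\<^sup>i y\<^sup>j\<close> in \<open>P\<close> is \<open>coeff (coeff P j) i\<close>.
\<close>

text \<open>
  Substituting the constant polynomial \<open>y\<close> for the outer variable leaves an element of \<open>\<real>[x]\<close>,
  which is then evaluated at \<open>x\<close>.
\<close>
definition eval2 :: "real poly poly \<Rightarrow> real \<Rightarrow> real \<Rightarrow> real" where
  "eval2 P x y = poly (poly P [:y:]) x"

text \<open>Inserting \<open>0\<close> only matters for \<open>P = 0\<close>, where it yields the convention \<open>deg 0 = 0\<close>.\<close>
definition total_degree :: "real poly poly \<Rightarrow> nat" where
  "total_degree P = Max (insert 0 {i + j | i j. coeff (coeff P j) i \<noteq> 0})"

lemma eval2_altdef:
  "eval2 P x y = (\<Sum>j\<le>degree P. \<Sum>i\<le>degree (coeff P j). coeff (coeff P j) i * x ^ i * y ^ j)"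
proof -
  have "eval2 P x y = (\<Sum>j\<le>degree P. poly (coeff P j) x * y ^ j)"
    unfolding eval2_def poly_altdef[of P] by (simp add: poly_sum poly_power)
  then show ?thesis by (simp add: poly_altdef sum_distrib_right)
qed

text \<open>The maximum in \<^const>\<open>total_degree\<close> is over a finite set.\<close>
lemma finite_total_degrees: "finite {i + j | i j. coeff (coeff P j) i \<noteq> 0}" for P :: "real poly poly"
proof -
  have "{i + j | i j. coeff (coeff P j) i \<noteq> 0} \<subseteq>
      (\<lambda>(j, i). i + j) ` (SIGMA j:{..degree P}. {..degree (coeff P j)})"
  proof
    fix n assume "n \<in> {i + j | i j. coeff (coeff P j) i \<noteq> 0}"
    then obtain i j where ij: "n = i + j" "coeff (coeff P j) i \<noteq> 0" by blast
    then have "coeff P j \<noteq> 0" by auto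
    with ij have "j \<le> degree P" "i \<le> degree (coeff P j)" by (auto intro: le_degree)
    with ij show "n \<in> (\<lambda>(j, i). i + j) ` (SIGMA j:{..degree P}. {..degree (coeff P j)})"
      by force
  qed
  then show ?thesis by (rule finite_subset) auto
qed

text \<open>
  For a continuous function on a compact interval the supremum is the maximum; the next lemmas
  show that this applies to both \<open>x \<mapsto> P(x, e\<^bsup>t(x)\<^esup>)\<close> and its derivative.
\<close>
lemma abs_SUP_attained:
  fixes f :: "real \<Rightarrow> real"
  assumes "a \<le> b" "continuous_on {a..b} f"
  shows "\<exists>x\<in>{a..b}. \<bar>f x\<bar> = (SUP x\<in>{a..b}. \<bar>f x\<bar>) \<and> (\<forall>y\<in>{a..b}. \<bar>f y\<bar> \<le> \<bar>f x\<bar>)"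
proof -
  have "continuous_on {a..b} (\<lambda>x. \<bar>f x\<bar>)" using assms(2) by (intro continuous_intros)
  then obtain x where x: "x \<in> {a..b}" "\<forall>y\<in>{a..b}. \<bar>f y\<bar> \<le> \<bar>f x\<bar>"
    using continuous_attains_sup[of "{a..b}" "\<lambda>x. \<bar>f x\<bar>"] assms(1) by auto
  then have "(SUP x\<in>{a..b}. \<bar>f x\<bar>) = \<bar>f x\<bar>" by (intro cSup_eq_maximum) auto
  with x show ?thesis by metis
qed

lemma eval2_exp_has_derivative:
  "((\<lambda>x. eval2 P x (exp (poly t x))) has_real_derivative
     (\<Sum>j\<le>degree P. (poly (pderiv (coeff P j)) x
        + real j * poly (pderiv t) x * poly (coeff P j) x) * exp (poly t x) ^ j)) (at x)"
proof -
  have eq: "eval2 P z (exp (poly t z)) = (\<Sum>j\<le>degree P. poly (coeff P j) z * exp (real j * poly t z))" for z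
    unfolding eval2_def poly_altdef[of P] by (simp add: poly_sum poly_power exp_of_nat_mult)
  show ?thesis unfolding eq
    by (auto intro!: derivative_eq_intros sum.cong simp: algebra_simps simp flip: exp_of_nat_mult)
qed

lemma continuous_on_eval2_exp: "continuous_on S (\<lambda>x. eval2 P x (exp (poly t x)))"
  by (rule DERIV_continuous_on, rule has_field_derivative_at_within, rule eval2_exp_has_derivative)

lemma continuous_on_deriv_eval2_exp: "continuous_on S (deriv (\<lambda>x. eval2 P x (exp (poly t x))))"
  unfolding DERIV_imp_deriv[OF eval2_exp_has_derivative, abs_def]
  by (intro continuous_intros)

end

theory Submission
  imports Defs "HOL-Complex_Analysis.Complex_Analysis"
    "HOL-Computational_Algebra.Fundamental_Theorem_Algebra"
begin

text \<open>
  Let \<open>F(z) = P(z, e\<^bsup>t(z)\<^esup>)\<close>, \<open>n = deg P\<close>, \<open>d = deg t \<ge> 1\<close>, and \<open>M(R)\<close> the maximum of \<open>\<bar>F\<bar>\<close> on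
  \<open>\<bar>z\<bar> \<le> R\<close>. On the scale \<open>R \<sim> n\<^bsup>1/d\<^esup>\<close> the values of \<open>t\<close> cover a disc of radius comparable to \<open>n\<close>,
  so that the \<open>2\<pi>i\<close>-periodicity of the exponential separates the variables \<open>x\<close> and \<open>y\<close> of \<open>P\<close>: the
  coefficients of \<open>P\<close> are at most \<open>e\<^bsup>O(n^2)\<^esup> M(R)\<close>, and hence \<open>M(BR) \<le> e\<^bsup>O(n^2)\<^esup> M(R)\<close>. Comparing Taylor
  coefficients, this growth bound passes to smaller discs, and on a neighbourhood of \<open>[a,b]\<close> the
  function \<open>F\<close> is a polynomial of degree \<open>N = O(n\<^sup>2)\<close> up to a negligible error. The inequality of
  A. A. Markov, with factor \<open>O(N\<^sup>2) = O(n\<^sup>4)\<close>, concludes. A constant \<open>t\<close> is reduced to \<open>t(x) = x\<close> by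
  changing \<open>P\<close>.
\<close>

section \<open>Polynomial inequalities on an interval: Bernstein-Walsh and Markov\<close>

text \<open>The preimages of \<open>z\<close> are the roots of \<open>v^2 - 2 z v + 1\<close>; their
  product is 1, so one of them lies outside the open unit disc.\<close>

lemma joukowski_surj:
  fixes z :: complex
  obtains u where "1 \<le> cmod u" "z = (u + 1 / u) / 2"
proof -
  define v where "v = z + csqrt (z\<^sup>2 - 1)"
  have q: "v\<^sup>2 - 2 * z * v + 1 = 0"
  proof -
    have "v\<^sup>2 - 2 * z * v + 1 = (csqrt (z\<^sup>2 - 1))\<^sup>2 - z\<^sup>2 + 1"
      unfolding v_def by (simp add: power2_sum algebra_simps power2_eq_square)
    then show ?thesis by simp
  qed
  then have v0: "v \<noteq> 0" by auto
  have zv: "z = (v + 1 / v) / 2"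
    using q v0 by (simp add: field_simps power2_eq_square)
  show thesis
  proof (cases "1 \<le> cmod v")
    case True
    then show ?thesis using that zv by blast
  next
    case False
    then have "1 \<le> cmod (1 / v)" using v0 by (simp add: norm_divide field_simps)
    moreover have "z = (1 / v + 1 / (1 / v)) / 2" using zv by simp
    ultimately show ?thesis using that by blast
  qed
qed

text \<open>Both distances come from perfect squares, \<open>z - 1 = (u - 1)^2 / (2 u)\<close> and
  \<open>z + 1 = (u + 1)^2 / (2 u)\<close>, and the parallelogram law adds them up. Thus circles go
  to ellipses with foci -1 and 1, and the size of \<open>u\<close> can be read off from
  \<open>z\<close>.\<close>

lemma joukowski_foci:
  fixes u :: complex
  assumes "u \<noteq> 0"
  shows "cmod ((u + 1 / u) / 2 - 1) + cmod ((u + 1 / u) / 2 + 1) = cmod u + 1 / cmod u"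
proof -
  have 1: "(u + 1 / u) / 2 - 1 = (u - 1)\<^sup>2 / (2 * u)" "(u + 1 / u) / 2 + 1 = (u + 1)\<^sup>2 / (2 * u)"
    using assms by (simp_all add: field_simps power2_eq_square)
  have "(cmod (u - 1))\<^sup>2 + (cmod (u + 1))\<^sup>2 = 2 * (cmod u)\<^sup>2 + 2"
    unfolding cmod_power2 by (simp add: power2_eq_square algebra_simps)
  then have "((cmod (u - 1))\<^sup>2 + (cmod (u + 1))\<^sup>2) / (2 * cmod u) = cmod u + 1 / cmod u"
    using assms by (simp add: field_simps power2_eq_square)
  then show ?thesis unfolding 1 by (simp add: norm_divide norm_power norm_mult add_divide_distrib)
qed

lemma poly_altdef_le:
  fixes p :: "'a::comm_semiring_1 poly"
  assumes "degree p \<le> n"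
  shows "poly p x = (\<Sum>i\<le>n. coeff p i * x ^ i)"
  unfolding poly_altdef
  by (rule sum.mono_neutral_left) (use assms in \<open>auto simp: not_le coeff_eq_0\<close>)

text \<open>
  The polynomial \<open>g(w) = w\<^sup>N p((w + 1/w)/2)\<close> is bounded by \<open>M\<close> on the unit circle, hence on the
  unit disc; the claim is this bound at \<open>w = 1/u\<close>.
\<close>
lemma poly_joukowski_bound:
  fixes p :: "complex poly"
  assumes deg: "degree p \<le> N"
    and bd: "\<And>x. -1 \<le> x \<Longrightarrow> x \<le> 1 \<Longrightarrow> cmod (poly p (of_real x)) \<le> M"
    and u: "1 \<le> cmod u"
  shows "cmod (poly p ((u + 1 / u) / 2)) \<le> cmod u ^ N * M"
proof -
  \<comment> \<open>In this form \<open>g\<close> is visibly a polynomial, hence holomorphic at 0 as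
    well, where \<open>w + 1 / w\<close> has its pole.\<close>
  define g where "g w = (\<Sum>i\<le>N. coeff p i * ((w\<^sup>2 + 1) / 2) ^ i * w ^ (N - i))" for w :: complex
  have g: "g w = w ^ N * poly p ((w + 1 / w) / 2)" if "w \<noteq> 0" for w
  proof -
    have "((w\<^sup>2 + 1) / 2) ^ i * w ^ (N - i) = w ^ N * ((w + 1 / w) / 2) ^ i" if "i \<le> N" for i
    proof -
      have "(w\<^sup>2 + 1) / 2 = w * ((w + 1 / w) / 2)"
        using \<open>w \<noteq> 0\<close> by (simp add: field_simps power2_eq_square)
      then have "((w\<^sup>2 + 1) / 2) ^ i * w ^ (N - i) = (w ^ i * w ^ (N - i)) * ((w + 1 / w) / 2) ^ i"
        by (simp only: power_mult_distrib) (simp add: mult_ac)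
      then show ?thesis using that by (simp flip: power_add)
    qed
    then show ?thesis
      unfolding g_def poly_altdef_le[OF deg] sum_distrib_left
      by (intro sum.cong) (auto simp: mult_ac)
  qed
  have "cmod (g w) \<le> M" if "w \<in> cball 0 1" for w
  proof (rule maximum_modulus_frontier[of g "cball 0 1"])
    show "g holomorphic_on interior (cball 0 1)"
      unfolding g_def by (intro holomorphic_intros) auto
    show "continuous_on (closure (cball 0 1)) g"
      unfolding g_def by (intro continuous_intros) auto
    show "cmod (g z) \<le> M" if "z \<in> frontier (cball 0 1)" for z
    proof -
      have z: "cmod z = 1" using that by simp
      \<comment> \<open>On the unit circle the Joukowski map is the real part, so it lands in
        [-1,1], where \<open>p\<close> is bounded by hypothesis.\<close>
      then have "1 / z = cnj z" by (simp add: inverse_complex_def divide_inverse complex_eq_iff cmod_def)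
      then have "(z + 1 / z) / 2 = of_real (Re z)" by (simp add: complex_add_cnj)
      moreover have "z \<noteq> 0" using z by auto
      moreover have "\<bar>Re z\<bar> \<le> 1" using abs_Re_le_cmod[of z] z by simp
      ultimately show ?thesis using g[of z] bd[of "Re z"] z by (simp add: norm_mult norm_power)
    qed
  qed (use that in auto)
  moreover have "u \<noteq> 0" using u by auto
  ultimately have "cmod (g (1 / u)) \<le> M" using u by (simp add: norm_divide)
  then have "cmod (1 / u ^ N * poly p ((u + 1 / u) / 2)) \<le> M"
    using \<open>u \<noteq> 0\<close> g[of "1 / u"] by (simp add: power_one_over add.commute)
  then show ?thesis using \<open>u \<noteq> 0\<close> by (simp add: norm_mult norm_divide norm_power field_simps)
qed

text \<open>Since \<open>s + 1 / s\<close> is strictly increasing for \<open>s\<close> at least 1, a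
  point inside the ellipse of parameter \<open>\<rho>\<close> has a preimage \<open>u\<close> with
  modulus at most \<open>\<rho>\<close>, and \<open>poly_joukowski_bound\<close> applies.\<close>

lemma bernstein_walsh_unit:
  fixes p :: "complex poly"
  assumes deg: "degree p \<le> N"
    and bd: "\<And>x. -1 \<le> x \<Longrightarrow> x \<le> 1 \<Longrightarrow> cmod (poly p (of_real x)) \<le> M"
    and rho: "1 \<le> \<rho>" "cmod (z - 1) + cmod (z + 1) \<le> \<rho> + 1 / \<rho>"
  shows "cmod (poly p z) \<le> \<rho> ^ N * M"
proof -
  obtain u where u: "1 \<le> cmod u" "z = (u + 1 / u) / 2" by (rule joukowski_surj)
  have M0: "0 \<le> M" using order_trans[OF norm_ge_zero bd[of 0]] by simp
  have "u \<noteq> 0" using u by auto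
  then have le: "cmod u + 1 / cmod u \<le> \<rho> + 1 / \<rho>" using joukowski_foci[of u] rho unfolding u(2) by simp
  have "cmod u \<le> \<rho>"
  proof (rule ccontr)
    assume *: "\<not> cmod u \<le> \<rho>"
    have "1 * 1 < cmod u * \<rho>" using * rho u by (intro mult_less_le_imp_less) auto
    then have "0 < (cmod u - \<rho>) * (cmod u * \<rho> - 1)" using * by simp
    then have "\<rho> + 1 / \<rho> < cmod u + 1 / cmod u"
      using rho \<open>u \<noteq> 0\<close> by (simp add: field_simps)
    then show False using le by simp
  qed
  then have "cmod u ^ N * M \<le> \<rho> ^ N * M" by (intro mult_right_mono power_mono M0) auto
  then show ?thesis using poly_joukowski_bound[OF deg bd u(1)] unfolding u(2) by (rule order_trans[rotated])
qed

text \<open>A circle of radius \<open>1 / (2 N^2)\<close> about a point of [-1,1] lies in the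
  ellipse of parameter \<open>1 + 2 / N\<close>. There Bernstein-Walsh costs only
  \<open>(1 + 2 / N) ^ N \<le> exp 2\<close>, and Cauchy's inequality on that circle supplies the
  factor \<open>2 N^2\<close>.\<close>

lemma markov_unit:
  fixes p :: "complex poly"
  assumes deg: "degree p \<le> N" and N: "1 \<le> N"
    and bd: "\<And>x. -1 \<le> x \<Longrightarrow> x \<le> 1 \<Longrightarrow> cmod (poly p (of_real x)) \<le> M"
    and x: "-1 \<le> x" "x \<le> 1"
  shows "cmod (poly (pderiv p) (of_real x)) \<le> 2 * exp 2 * real N ^ 2 * M"
proof -
  define \<delta> where "\<delta> = 1 / (2 * real N ^ 2)"
  have d0: "\<delta> > 0" using N by (simp add: \<delta>_def)
  have M0: "0 \<le> M" using order_trans[OF norm_ge_zero bd[of 0]] by simp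
  have "cmod (poly p z) \<le> exp 2 * M" if z: "cmod (of_real x - z) = \<delta>" for z
  proof -
    define \<rho> where "\<rho> = 1 + 2 / real N"
    have "cmod (z - 1) \<le> cmod (z - of_real x) + cmod (of_real x - 1)"
      using norm_triangle_ineq[of "z - of_real x" "of_real x - 1"] by simp
    moreover have "cmod (z + 1) \<le> cmod (z - of_real x) + cmod (of_real x + 1)"
      using norm_triangle_ineq[of "z - of_real x" "of_real x + 1"] by simp
    moreover have "cmod (of_real x - 1) = 1 - x"
      using x norm_of_real[of "x - 1", where 'a = complex] by (simp del: norm_of_real)
    moreover have "cmod (of_real x + 1) = 1 + x"
      using x norm_of_real[of "x + 1", where 'a = complex] by (simp del: norm_of_real)
    ultimately have "cmod (z - 1) + cmod (z + 1) \<le> 2 + 2 * \<delta>"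
      using z by (simp add: norm_minus_commute)
    also have "2 * \<delta> = 1 / real N ^ 2" by (simp add: \<delta>_def)
    also have "2 + 1 / real N ^ 2 \<le> \<rho> + 1 / \<rho>"
    proof -
      have "\<rho> + 1 / \<rho> = 2 + 4 / (real N * (real N + 2))"
        using N unfolding \<rho>_def by (simp add: field_simps add_nonneg_eq_0_iff)
      moreover have "4 / (4 * real N ^ 2) \<le> 4 / (real N * (real N + 2))"
        using N by (intro divide_left_mono) (auto simp: power2_eq_square)
      ultimately show ?thesis by simp
    qed
    finally have "cmod (poly p z) \<le> \<rho> ^ N * M"
      by (intro bernstein_walsh_unit[OF deg bd]) (auto simp: \<rho>_def)
    moreover have "\<rho> ^ N \<le> exp 2"
      unfolding \<rho>_def using exp_ge_one_plus_x_over_n_power_n[of N 2] N by simp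
    ultimately show ?thesis using M0 by (meson mult_right_mono order_trans)
  qed
  then have "cmod ((deriv ^^ 1) (poly p) (of_real x)) \<le> fact 1 * (exp 2 * M) / \<delta> ^ 1"
    by (intro Cauchy_inequality d0) (auto intro!: holomorphic_intros continuous_intros)
  moreover have "deriv (poly p) (of_real x) = poly (pderiv p) (of_real x)"
    by (rule DERIV_imp_deriv) (rule poly_DERIV)
  ultimately show ?thesis using N by (simp add: \<delta>_def mult_ac)
qed

lemma affine_interval:
  fixes a b x :: real
  assumes "a < b" "-1 \<le> x" "x \<le> 1"
  shows "(a + b) / 2 + x * ((b - a) / 2) \<in> {a..b}"
proof -
  have "\<bar>x * ((b - a) / 2)\<bar> \<le> 1 * ((b - a) / 2)"
    unfolding abs_mult using assms by (intro mult_mono) auto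
  then show ?thesis by (auto simp: field_simps abs_le_iff)
qed

lemma bernstein_walsh:
  fixes a b :: real
  assumes ab: "a < b"
  obtains \<rho> :: real where "1 \<le> \<rho>"
    "\<And>p N M z. degree p \<le> N \<Longrightarrow> (\<And>x. x \<in> {a..b} \<Longrightarrow> cmod (poly p (of_real x)) \<le> M)
      \<Longrightarrow> cmod z \<le> r \<Longrightarrow> cmod (poly p z) \<le> \<rho> ^ N * M"
proof -
  define m h where "m = (a + b) / 2" and "h = (b - a) / 2"
  have h: "h > 0" using ab by (simp add: h_def)
  \<comment> \<open>After rescaling [a,b] to [-1,1], the disc of radius \<open>r\<close> goes into
    the disc of radius \<open>(\<bar>r\<bar> + \<bar>m\<bar>) / h\<close>, where the sum of the
    distances to the foci is at most this \<open>\<rho>\<close>.\<close>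
  define \<rho> where "\<rho> = 2 * ((\<bar>r\<bar> + \<bar>m\<bar>) / h) + 2"
  have rho: "1 \<le> \<rho>" using h by (simp add: \<rho>_def add_nonneg_nonneg)
  have "cmod (poly p z) \<le> \<rho> ^ N * M" if deg: "degree p \<le> N"
    and bd: "\<And>x. x \<in> {a..b} \<Longrightarrow> cmod (poly p (of_real x)) \<le> M" and z: "cmod z \<le> r" for p N M z
  proof -
    define w where "w = (z - of_real m) / of_real h"
    have "cmod w \<le> (\<bar>r\<bar> + \<bar>m\<bar>) / h"
      using z h norm_triangle_ineq4[of z "of_real m"] by (simp add: w_def norm_divide divide_right_mono)
    moreover have "cmod (w - 1) + cmod (w + 1) \<le> 2 * cmod w + 2"
      using norm_triangle_ineq4[of w 1] norm_triangle_ineq[of w 1] by simp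
    moreover have "1 / \<rho> \<ge> 0" using rho by simp
    ultimately have "cmod (w - 1) + cmod (w + 1) \<le> \<rho> + 1 / \<rho>" unfolding \<rho>_def by linarith
    then have "cmod (poly (pcompose p [:of_real m, of_real h:]) w) \<le> \<rho> ^ N * M"
    proof (intro bernstein_walsh_unit rho)
      show "degree (pcompose p [:of_real m, of_real h:]) \<le> N" using deg h by (simp add: degree_pcompose)
      show "cmod (poly (pcompose p [:of_real m, of_real h:]) (of_real x)) \<le> M" if "-1 \<le> x" "x \<le> 1" for x
        using bd[OF affine_interval[OF ab that]] by (simp add: poly_pcompose m_def h_def)
    qed
    then show ?thesis using h by (simp add: poly_pcompose w_def)
  qed
  with rho show thesis using that by blast
qed

lemma markov:
  fixes a b :: real
  assumes ab: "a < b"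
  obtains C :: real where
    "\<And>p N M x. degree p \<le> N \<Longrightarrow> 1 \<le> N \<Longrightarrow> (\<And>x. x \<in> {a..b} \<Longrightarrow> cmod (poly p (of_real x)) \<le> M)
      \<Longrightarrow> x \<in> {a..b} \<Longrightarrow> cmod (poly (pderiv p) (of_real x)) \<le> C * real N ^ 2 * M"
proof -
  define m h where "m = (a + b) / 2" and "h = (b - a) / 2"
  have h: "h > 0" using ab by (simp add: h_def)
  have "cmod (poly (pderiv p) (of_real x)) \<le> 2 * exp 2 / h * real N ^ 2 * M"
    if deg: "degree p \<le> N" and N: "1 \<le> N"
    and bd: "\<And>x. x \<in> {a..b} \<Longrightarrow> cmod (poly p (of_real x)) \<le> M" and x: "x \<in> {a..b}" for p N M x
  proof -
    define w where "w = (x - m) / h"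
    have "cmod (poly (pderiv (pcompose p [:of_real m, of_real h:])) (of_real w)) \<le> 2 * exp 2 * real N ^ 2 * M"
    proof (intro markov_unit N)
      show "degree (pcompose p [:of_real m, of_real h:]) \<le> N" using deg h by (simp add: degree_pcompose)
      show "cmod (poly (pcompose p [:of_real m, of_real h:]) (of_real x)) \<le> M" if "-1 \<le> x" "x \<le> 1" for x
        using bd[OF affine_interval[OF ab that]] by (simp add: poly_pcompose m_def h_def)
      show "-1 \<le> w" "w \<le> 1" using x h by (auto simp: w_def m_def h_def field_simps)
    qed
    moreover have "complex_of_real m + complex_of_real w * complex_of_real h = complex_of_real x"
      using h by (simp add: w_def)
    ultimately show ?thesis
      using h by (simp add: pderiv_pcompose poly_pcompose norm_mult pderiv_pCons field_simps)
  qed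
  then show thesis using that by blast
qed

section \<open>Taylor coefficients, and from growth to a derivative bound\<close>

lemma higher_deriv_poly: "(deriv ^^ k) (poly p) = poly ((pderiv ^^ k) p)"
  for p :: "complex poly"
proof (induction k)
  case (Suc k)
  have "deriv (poly q) = poly (pderiv q)" for q :: "complex poly"
    by (rule ext) (rule DERIV_imp_deriv[OF poly_DERIV])
  with Suc show ?case by simp
qed auto

lemma poly_coeff_bound:
  fixes p :: "complex poly"
  assumes "0 < r" "\<And>z. cmod z = r \<Longrightarrow> cmod (poly p z) \<le> M"
  shows "cmod (coeff p k) * r ^ k \<le> M"
proof -
  have "cmod ((deriv ^^ k) (poly p) 0) \<le> fact k * M / r ^ k"
    using assms by (intro Cauchy_inequality) (auto intro!: holomorphic_intros continuous_intros)
  moreover have "(deriv ^^ k) (poly p) 0 = fact k * coeff p k"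
    by (simp add: higher_deriv_poly poly_0_coeff_0 coeff_higher_pderiv pochhammer_fact)
  ultimately have "fact k * cmod (coeff p k) \<le> fact k * (M / r ^ k)"
    by (simp add: norm_mult)
  then have "cmod (coeff p k) \<le> M / r ^ k" by (subst (asm) mult_le_cancel_left_pos) auto
  then show ?thesis using assms(1) by (simp add: field_simps)
qed

text \<open>Each term with \<open>j \<ge> N\<close> is at most \<open>S / B ^ j\<close>, so the tail
  is dominated by a geometric series of ratio 1/2 starting at \<open>S / B ^ N\<close>.\<close>

lemma power_series_tail_bound:
  fixes a :: "nat \<Rightarrow> complex"
  assumes sums: "(\<lambda>j. a j * z ^ j) sums s"
    and bd: "\<And>j. N \<le> j \<Longrightarrow> cmod (a j) * (B * r) ^ j \<le> S"
    and B: "2 \<le> B" and z: "cmod z \<le> r"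
  shows "cmod (s - (\<Sum>j<N. a j * z ^ j)) \<le> 2 * S / B ^ N"
proof (rule norm_sums_le)
  show "(\<lambda>i. a (i + N) * z ^ (i + N)) sums (s - (\<Sum>j<N. a j * z ^ j))"
    by (rule sums_split_initial_segment[OF sums])
  show "(\<lambda>i. S / B ^ N * (1 / 2) ^ i) sums (2 * S / B ^ N)"
    using sums_mult[OF geometric_sums[of "1 / 2 :: real"], of "S / B ^ N"] by (simp add: mult_ac)
  show "cmod (a (i + N) * z ^ (i + N)) \<le> S / B ^ N * (1 / 2) ^ i" for i
  proof -
    have "0 \<le> r" using order_trans[OF norm_ge_zero z] .
    then have "0 \<le> cmod (a (i + N)) * (B * r) ^ (i + N)" using B by simp
    then have S0: "0 \<le> S" using bd[of "i + N"] by simp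
    have "cmod (a (i + N) * z ^ (i + N)) \<le> cmod (a (i + N)) * r ^ (i + N)"
      unfolding norm_mult norm_power using z by (intro mult_left_mono power_mono) auto
    also have "\<dots> \<le> S / B ^ (i + N)"
      using bd[of "i + N"] B by (simp add: field_simps)
    also have "\<dots> = S / B ^ N * (1 / B) ^ i" by (simp add: power_add field_simps)
    also have "\<dots> \<le> S / B ^ N * (1 / 2) ^ i"
      using B S0 by (intro mult_left_mono power_mono) (auto simp: field_simps)
    finally show ?thesis .
  qed
qed

text \<open>
  The hypothesis bounds the growth of \<open>F\<close> between radius \<open>R\<close> and radius \<open>B R\<close> for one \<open>R\<close>,
  which may depend on \<open>n\<close> and \<open>F\<close>. A Taylor coefficient \<open>a\<^sub>k\<close> with \<open>k < N = O(n\<^sup>2)\<close> dominates on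
  \<open>\<bar>z\<bar> = R\<close>; since \<open>(r/R)\<^sup>j \<le> (r/R)\<^sup>k\<close> for \<open>j \<ge> k\<close>, the coefficients of order at least \<open>N\<close> stay
  controlled by it on the fixed radius \<open>r\<close>. So \<open>F\<close> is a polynomial of degree \<open>O(n\<^sup>2)\<close> near
  \<open>[a,b]\<close>, up to a negligible error.
\<close>
lemma deriv_bound_of_doubling:
  fixes a b :: real
  assumes ab: "a < b"
  obtains B r :: real where "2 \<le> B" "0 < r"
    "\<And>D. 1 \<le> D \<Longrightarrow> \<exists>C. \<forall>F n R X E x. F holomorphic_on UNIV \<longrightarrow> 1 \<le> n \<longrightarrow> r \<le> R \<longrightarrow>
      (\<forall>z. cmod z \<le> B * R \<longrightarrow> cmod (F z) \<le> D ^ (n\<^sup>2) * X) \<longrightarrow>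
      (\<exists>z. cmod z \<le> R \<and> cmod (F z) = X) \<longrightarrow>
      (\<forall>x\<in>{a..b}. cmod (F (of_real x)) \<le> E) \<longrightarrow> x \<in> {a..b} \<longrightarrow>
      cmod (deriv F (of_real x)) \<le> C * real n ^ 4 * E"
proof -
  \<comment> \<open>The summand 1 leaves room for unit circles about points of [a,b], used in the
    Cauchy estimate of the error term.\<close>
  define r where "r = \<bar>a\<bar> + \<bar>b\<bar> + 1"
  have r0: "0 < r" by (simp add: r_def)
  obtain \<rho> where rho: "1 \<le> \<rho>" and
    bw: "\<And>p N M z. degree p \<le> N \<Longrightarrow> (\<And>x. x \<in> {a..b} \<Longrightarrow> cmod (poly p (of_real x)) \<le> M)
      \<Longrightarrow> cmod z \<le> r \<Longrightarrow> cmod (poly p z) \<le> \<rho> ^ N * M"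
    using bernstein_walsh[OF ab, of r] by blast
  obtain CM where mk: "\<And>p N M x. degree p \<le> N \<Longrightarrow> 1 \<le> N \<Longrightarrow> (\<And>x. x \<in> {a..b} \<Longrightarrow> cmod (poly p (of_real x)) \<le> M)
      \<Longrightarrow> x \<in> {a..b} \<Longrightarrow> cmod (poly (pderiv p) (of_real x)) \<le> CM * real N ^ 2 * M"
    using markov[OF ab] by blast
  \<comment> \<open>The factor \<open>\<rho>\<close> pays for the Bernstein-Walsh loss; the factor 2
    leaves a gain that makes the Taylor tail small.\<close>
  define B where "B = 2 * \<rho>"
  have B: "2 \<le> B" using rho by (simp add: B_def)
  have "\<exists>C. \<forall>F n R X E x. F holomorphic_on UNIV \<longrightarrow> 1 \<le> n \<longrightarrow> r \<le> R \<longrightarrow>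
      (\<forall>z. cmod z \<le> B * R \<longrightarrow> cmod (F z) \<le> D ^ (n\<^sup>2) * X) \<longrightarrow>
      (\<exists>z. cmod z \<le> R \<and> cmod (F z) = X) \<longrightarrow>
      (\<forall>x\<in>{a..b}. cmod (F (of_real x)) \<le> E) \<longrightarrow> x \<in> {a..b} \<longrightarrow>
      cmod (deriv F (of_real x)) \<le> C * real n ^ 4 * E" if D: "1 \<le> D" for D
  proof -
    obtain \<nu> where nu: "4 * D < 2 ^ \<nu>" using real_arch_pow[of 2 "4 * D"] by auto
    have nu1: "1 \<le> \<nu>" using nu D by (cases \<nu>) auto
    \<comment> \<open>Markov at degree \<open>3 N\<close> and the bound
      \<open>E + \<tau> \<le> 2 E\<close> give \<open>9 * 2 = 18\<close>; the summand 1 covers the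
      derivative of the error.\<close>
    define C where "C = 18 * CM * real \<nu> ^ 2 + 1"
    have "cmod (deriv F (of_real x)) \<le> C * real n ^ 4 * E"
      if hol: "F holomorphic_on UNIV" and n: "1 \<le> n" and R: "r \<le> R"
        and grow: "\<And>z. cmod z \<le> B * R \<Longrightarrow> cmod (F z) \<le> D ^ (n\<^sup>2) * X"
        and att: "\<exists>z. cmod z \<le> R \<and> cmod (F z) = X"
        and E: "\<And>x. x \<in> {a..b} \<Longrightarrow> cmod (F (of_real x)) \<le> E" and x: "x \<in> {a..b}"
      for F n R X E x
    proof -
      define N where "N = \<nu> * n\<^sup>2"
      have N1: "1 \<le> N" using nu1 n by (simp add: N_def)
      define c where "c j = (deriv ^^ j) F 0 / fact j" for j
      have R0: "0 < R" using R r0 by simp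
      have X0: "0 \<le> X" using att by auto
      have E0: "0 \<le> E" using order_trans[OF norm_ge_zero E[OF x]] .
      have DN: "4 * D ^ (n\<^sup>2) \<le> 2 ^ N"
      proof -
        have "4 * D ^ (n\<^sup>2) \<le> 4 ^ (n\<^sup>2) * D ^ (n\<^sup>2)"
          using D n self_le_power[of "4 :: real" "n\<^sup>2"] by (intro mult_right_mono) auto
        also have "\<dots> \<le> (2 ^ \<nu>) ^ (n\<^sup>2)"
          unfolding power_mult_distrib[symmetric] using nu D by (intro power_mono) auto
        finally show ?thesis by (simp add: N_def power_mult)
      qed
      have F_sums: "(\<lambda>j. c j * z ^ j) sums F z" for z
        using holomorphic_power_series[of F 0 "cmod z + 1" z] hol
        by (auto simp: c_def intro: holomorphic_on_subset)
      have c_le: "cmod (c j) * (B * R) ^ j \<le> D ^ (n\<^sup>2) * X" for j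
      proof -
        have BR: "0 < B * R" using B R0 by simp
        have "cmod ((deriv ^^ j) F 0) \<le> fact j * (D ^ (n\<^sup>2) * X) / (B * R) ^ j"
          using grow BR hol
          by (intro Cauchy_inequality)
            (auto intro: holomorphic_on_subset holomorphic_on_imp_continuous_on)
        then have "cmod (c j) \<le> fact j * (D ^ (n\<^sup>2) * X) / (B * R) ^ j / fact j"
          unfolding c_def norm_divide norm_fact by (rule divide_right_mono) simp
        also have "\<dots> = D ^ (n\<^sup>2) * X / (B * R) ^ j" by simp
        finally show ?thesis using BR by (simp only: pos_le_divide_eq[OF zero_less_power])
      qed
      \<comment> \<open>Otherwise the first \<open>N\<close> terms add up to less than
        \<open>X / 2\<close> on the disc of radius \<open>R\<close>. The tail is at most
        \<open>X / 2\<close> there, so the value of modulus \<open>X\<close> could not be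
        attained.\<close>
      obtain k where k: "k < N" "X \<le> 2 * real N * (cmod (c k) * R ^ k)"
      proof (rule ccontr)
        assume "\<not> thesis"
        then have *: "cmod (c k) * R ^ k < X / (2 * real N)" if "k < N" for k
          using that \<open>\<And>k. k < N \<Longrightarrow> X \<le> 2 * real N * (cmod (c k) * R ^ k) \<Longrightarrow> thesis\<close> N1
          by (force simp: field_simps)
        obtain z where z: "cmod z \<le> R" "cmod (F z) = X" using att by auto
        have "cmod (F z - (\<Sum>j<N. c j * z ^ j)) \<le> 2 * (D ^ (n\<^sup>2) * X) / B ^ N"
          by (rule power_series_tail_bound[OF F_sums c_le B z(1)])
        also have "\<dots> \<le> X / 2"
        proof -
          have "4 * D ^ (n\<^sup>2) \<le> B ^ N" using DN power_mono[OF B, of N] by simp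
          then have "4 * D ^ (n\<^sup>2) * X \<le> B ^ N * X" using X0 by (rule mult_right_mono)
          then show ?thesis using B by (simp add: field_simps)
        qed
        finally have 1: "cmod (F z - (\<Sum>j<N. c j * z ^ j)) \<le> X / 2" .
        have "cmod (\<Sum>j<N. c j * z ^ j) \<le> (\<Sum>j<N. cmod (c j) * R ^ j)"
          by (rule sum_norm_le) (auto simp: norm_mult norm_power z intro!: mult_left_mono power_mono)
        also have "\<dots> < (\<Sum>j<N. X / (2 * real N))"
          using * N1 by (intro sum_strict_mono) (auto simp: lessThan_empty_iff)
        also have "\<dots> = X / 2" using N1 by simp
        finally show False
          using 1 z norm_triangle_sub[of "F z" "\<Sum>j<N. c j * z ^ j"] by simp
      qed
      define Y where "Y = cmod (c k) * r ^ k"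
      have Y0: "0 \<le> Y" using r0 by (simp add: Y_def)
      have c_le': "cmod (c j) * (B * r) ^ j \<le> 2 * real N * D ^ (n\<^sup>2) * Y" if "N \<le> j" for j
      proof -
        have "cmod (c j) * (B * r) ^ j = cmod (c j) * (B * R) ^ j * (r / R) ^ j"
          using R0 by (simp add: power_mult_distrib power_divide)
        also have "\<dots> \<le> D ^ (n\<^sup>2) * X * (r / R) ^ j"
          using c_le r0 R0 by (intro mult_right_mono) auto
        also have "\<dots> \<le> D ^ (n\<^sup>2) * X * (r / R) ^ k"
          using D X0 r0 R R0 k that by (intro mult_left_mono power_decreasing) auto
        also have "\<dots> \<le> D ^ (n\<^sup>2) * (2 * real N * (cmod (c k) * R ^ k)) * (r / R) ^ k"
          using D k r0 R0 by (intro mult_right_mono mult_left_mono) auto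
        also have "\<dots> = 2 * real N * D ^ (n\<^sup>2) * Y"
          using R0 by (simp add: Y_def power_divide)
        finally show ?thesis .
      qed
      \<comment> \<open>Truncating at \<open>3 N\<close> gains \<open>2 ^ (3 * N)\<close> in the
        tail: one factor \<open>2 ^ N\<close> each for \<open>4 * D ^ (n\<^sup>2)\<close>, for
        \<open>N\<close> and for 2.\<close>
      define T where "T = (\<Sum>j<3 * N. monom (c j) j)"
      have T: "poly T z = (\<Sum>j<3 * N. c j * z ^ j)" for z
        by (simp add: T_def poly_sum poly_monom)
      have degT: "degree T \<le> 3 * N"
        unfolding T_def by (rule degree_sum_le) (auto intro: order_trans[OF degree_monom_le])
      \<comment> \<open>The error is half of what Bernstein-Walsh can detect:
        \<open>Y \<le> \<rho> ^ (3 * N) * (E + \<tau>)\<close> contains \<open>Y / 2\<close> on the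
        right, and absorbing it yields \<open>\<tau> \<le> E\<close>.\<close>
      define \<tau> where "\<tau> = Y / (2 * \<rho> ^ (3 * N))"
      have tail: "cmod (F z - poly T z) \<le> \<tau>" if "cmod z \<le> r" for z
      proof -
        have "cmod (F z - poly T z) \<le> 2 * (2 * real N * D ^ (n\<^sup>2) * Y) / B ^ (3 * N)"
          unfolding T by (rule power_series_tail_bound[OF F_sums c_le' B that]) simp
        also have "\<dots> = (4 * D ^ (n\<^sup>2)) * real N * 2 * (Y / (2 * \<rho> ^ (3 * N))) / 2 ^ (3 * N)"
          by (simp add: B_def power_mult_distrib mult_ac)
        also have "\<dots> \<le> (2 ^ N * 2 ^ N * 2 ^ N) * (Y / (2 * \<rho> ^ (3 * N))) / 2 ^ (3 * N)"
        proof (intro divide_right_mono mult_right_mono mult_mono)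
          show "real N \<le> 2 ^ N" using of_nat_less_two_power[of N, where 'a = real] by simp
          show "(2 :: real) \<le> 2 ^ N" using self_le_power[of "2 :: real" N] N1 by simp
        qed (use DN D Y0 rho in auto)
        also have "(2 :: real) ^ N * 2 ^ N * 2 ^ N = 2 ^ (3 * N)"
          unfolding power_add[symmetric] by (rule arg_cong[of _ _ "(^) 2"]) simp
        also have "2 ^ (3 * N) * (Y / (2 * \<rho> ^ (3 * N))) / 2 ^ (3 * N) = \<tau>" by (simp add: \<tau>_def)
        finally show ?thesis .
      qed
      have xr: "cmod (of_real x) \<le> r - 1" if "x \<in> {a..b}" for x
        using that by (auto simp: r_def)
      have T_le: "cmod (poly T (of_real x)) \<le> E + \<tau>" if "x \<in> {a..b}" for x
        using norm_triangle_sub[of "poly T (of_real x)" "F (of_real x)"] E[OF that]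
          tail[of "of_real x"] xr[OF that] by (simp add: norm_minus_commute)
      have "coeff T k = c k" using k by (simp add: T_def coeff_sum)
      then have "Y \<le> \<rho> ^ (3 * N) * (E + \<tau>)"
        using poly_coeff_bound[OF r0, of T "\<rho> ^ (3 * N) * (E + \<tau>)" k] bw[OF degT T_le]
        by (simp add: Y_def)
      then have tau: "\<tau> \<le> E"
        using rho by (simp add: \<tau>_def field_simps)
      have "cmod ((deriv ^^ 1) (\<lambda>z. F z - poly T z) (of_real x)) \<le> fact 1 * \<tau> / 1 ^ 1"
      proof (rule Cauchy_inequality)
        show "cmod (F z - poly T z) \<le> \<tau>" if "cmod (of_real x - z) = 1" for z
          using that xr[OF x] norm_triangle_sub[of z "of_real x"]
          by (intro tail) (simp add: norm_minus_commute)
      qed (use hol in \<open>auto intro!: holomorphic_intros continuous_intros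
            intro: holomorphic_on_subset holomorphic_on_imp_continuous_on\<close>)
      moreover have "deriv (\<lambda>z. F z - poly T z) (of_real x) = deriv F (of_real x) - poly (pderiv T) (of_real x)"
        using hol by (intro DERIV_imp_deriv DERIV_diff poly_DERIV holomorphic_derivI[of F UNIV]) auto
      ultimately have 1: "cmod (deriv F (of_real x) - poly (pderiv T) (of_real x)) \<le> E"
        using tau by simp
      have "cmod (poly (pderiv T) (of_real x)) \<le> CM * real (3 * N) ^ 2 * (2 * E)"
        using T_le tau N1 by (intro mk[OF degT _ _ x]) fastforce+
      then have "cmod (deriv F (of_real x)) \<le> CM * real (3 * N) ^ 2 * (2 * E) + 1 * E"
        using 1 norm_triangle_sub[of "deriv F (of_real x)" "poly (pderiv T) (of_real x)"] by simp
      also have "\<dots> \<le> CM * real (3 * N) ^ 2 * (2 * E) + real n ^ 4 * E"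
        using n E0 by (intro add_left_mono mult_right_mono) auto
      also have "\<dots> = C * real n ^ 4 * E"
        by (simp add: C_def N_def power_mult_distrib algebra_simps flip: power_mult)
      finally show ?thesis .
    qed
    then show ?thesis by blast
  qed
  with B r0 show thesis using that by blast
qed

section \<open>Growth of polynomials and Lagrange interpolation\<close>

lemma poly_norm_le:
  fixes p :: "complex poly"
  obtains K :: real where "1 \<le> K"
    "\<And>m R z. degree p \<le> m \<Longrightarrow> 1 \<le> R \<Longrightarrow> cmod z \<le> R \<Longrightarrow> cmod (poly p z) \<le> K * R ^ m"
proof
  define K where "K = 1 + (\<Sum>i\<le>degree p. cmod (coeff p i))"
  show "1 \<le> K" by (simp add: K_def sum_nonneg)
  show "cmod (poly p z) \<le> K * R ^ m" if "degree p \<le> m" "1 \<le> R" "cmod z \<le> R" for m R z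
  proof -
    have "cmod (poly p z) \<le> (\<Sum>i\<le>degree p. cmod (coeff p i) * R ^ m)"
      unfolding poly_altdef
    proof (rule sum_norm_le)
      fix i assume "i \<in> {..degree p}"
      then have "cmod z ^ i \<le> R ^ m"
        using that power_mono[of "cmod z" R i] power_increasing[of i m R] by simp
      then show "cmod (coeff p i * z ^ i) \<le> cmod (coeff p i) * R ^ m"
        by (simp add: norm_mult norm_power mult_left_mono)
    qed
    also have "\<dots> \<le> K * R ^ m"
      using that by (simp add: K_def distrib_right flip: sum_distrib_right)
    finally show ?thesis .
  qed
qed

text \<open>For large \<open>z\<close> the lower-order part is at most half of the leading term. The
  1 on the right covers the remaining bounded disc.\<close>

lemma poly_norm_ge:
  fixes p :: "complex poly"
  assumes d: "0 < degree p"
  obtains K :: real where "1 \<le> K" "\<And>z. cmod z ^ degree p \<le> K * (1 + cmod (poly p z))"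
proof -
  define a q where "a = lead_coeff p" and "q = p - monom a (degree p)"
  have a: "0 < cmod a" using d by (auto simp: a_def)
  have degq: "degree q \<le> degree p - 1"
  proof (rule degree_le, intro allI impI)
    fix i assume "degree p - 1 < i"
    then have "i = degree p \<or> degree p < i" by linarith
    then show "coeff q i = 0" by (auto simp: q_def a_def coeff_eq_0)
  qed
  obtain K1 where K1: "1 \<le> K1"
    "\<And>m R z. degree q \<le> m \<Longrightarrow> 1 \<le> R \<Longrightarrow> cmod z \<le> R \<Longrightarrow> cmod (poly q z) \<le> K1 * R ^ m"
    by (rule poly_norm_le[of q]) blast
  \<comment> \<open>From this modulus on, \<open>K1 \<le> cmod a / 2 * cmod z\<close>, so half of
    the leading term absorbs \<open>q\<close>.\<close>
  define L where "L = 1 + 2 * K1 / cmod a"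
  have L: "1 \<le> L" using a K1 by (simp add: L_def)
  have "cmod z ^ degree p \<le> (2 / cmod a + L ^ degree p) * (1 + cmod (poly p z))" for z
  proof (cases "L \<le> cmod z")
    case True
    have "cmod a * cmod z ^ degree p = cmod (poly p z - poly q z)"
      by (simp add: q_def poly_monom norm_mult norm_power)
    also have "\<dots> \<le> cmod (poly p z) + K1 * cmod z ^ (degree p - 1)"
      using norm_triangle_ineq4[of "poly p z" "poly q z"] K1(2)[OF degq, of "cmod z" z] True L by simp
    also have "K1 * cmod z ^ (degree p - 1) \<le> cmod a / 2 * cmod z * cmod z ^ (degree p - 1)"
    proof (rule mult_right_mono)
      have "2 * K1 / cmod a \<le> cmod z" using True by (simp add: L_def)
      then show "K1 \<le> cmod a / 2 * cmod z" using a by (simp add: field_simps)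
    qed auto
    also have "\<dots> = cmod a / 2 * cmod z ^ degree p"
      using d by (simp add: power_eq_if)
    finally have "cmod z ^ degree p \<le> 2 / cmod a * cmod (poly p z)"
      using a by (simp add: field_simps)
    also have "\<dots> \<le> (2 / cmod a + L ^ degree p) * (1 + cmod (poly p z))"
      using a L by (intro mult_mono) auto
    finally show ?thesis .
  next
    case False
    then have "cmod z ^ degree p \<le> L ^ degree p * 1" using power_mono[of "cmod z" L] by simp
    also have "\<dots> \<le> (2 / cmod a + L ^ degree p) * (1 + cmod (poly p z))"
      using a L by (intro mult_mono) auto
    finally show ?thesis .
  qed
  moreover have "1 \<le> 2 / cmod a + L ^ degree p"
    using one_le_power[OF L, of "degree p"] by (simp add: add_increasing)
  ultimately show thesis using that by blast
qed

text \<open>In the interpolation formula each of the \<open>n\<close> factors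
  \<open>(x - z j) / (z k - z j)\<close> of a basis polynomial is at most
  \<open>(1 + R) / \<delta>\<close>.\<close>

lemma lagrange_bound:
  fixes p :: "complex poly" and z :: "nat \<Rightarrow> complex"
  assumes deg: "degree p \<le> n" and \<delta>: "0 < \<delta>"
    and sep: "\<And>j k. j \<le> n \<Longrightarrow> k \<le> n \<Longrightarrow> j \<noteq> k \<Longrightarrow> \<delta> \<le> cmod (z j - z k)"
    and node: "\<And>k. k \<le> n \<Longrightarrow> cmod (z k) \<le> R" "\<And>k. k \<le> n \<Longrightarrow> cmod (poly p (z k)) \<le> M"
    and x: "cmod x \<le> 1"
  shows "cmod (poly p x) \<le> (real n + 1) * (((1 + R) / \<delta>) ^ n * M)"
proof -
  have zne: "z j \<noteq> z k" if "j \<le> n" "k \<le> n" "j \<noteq> k" for j k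
    using sep[OF that] \<delta> by auto
  define w where "w k = (\<Prod>j\<in>{..n} - {k}. z k - z j)" for k
  define l where "l k = (\<Prod>j\<in>{..n} - {k}. [:- z j, 1:])" for k
  define q where "q = (\<Sum>k\<le>n. smult (poly p (z k) / w k) (l k))"
  have l: "poly (l k) y = (\<Prod>j\<in>{..n} - {k}. y - z j)" for k y
    by (simp add: l_def poly_prod)
  have "p = q"
  proof (rule poly_eqI_degree[of "z ` {..n}"])
    have "inj_on z {..n}" using zne by (meson atMost_iff inj_onI)
    then have card: "card (z ` {..n}) = n + 1" by (simp add: card_image)
    then show "degree p < card (z ` {..n})" using deg by simp
    have "degree (l k) \<le> n" if "k \<le> n" for k
    proof -
      have "degree (l k) \<le> sum (degree \<circ> (\<lambda>j. [:- z j, 1:])) ({..n} - {k})"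
        unfolding l_def by (rule degree_prod_sum_le) simp
      then show ?thesis using that by simp
    qed
    then have "degree q \<le> n"
      unfolding q_def by (intro degree_sum_le) (auto intro: order_trans[OF degree_smult_le])
    then show "degree q < card (z ` {..n})" using card by simp
    show "poly p y = poly q y" if "y \<in> z ` {..n}" for y
    proof -
      obtain m where m: "m \<le> n" "y = z m" using \<open>y \<in> z ` {..n}\<close> by blast
      have "poly q y = (\<Sum>k\<le>n. if k = m then poly p (z m) else 0)"
        unfolding q_def poly_sum
      proof (rule sum.cong)
        fix k assume "k \<in> {..n}"
        have "w m \<noteq> 0" using zne m by (auto simp: w_def)
        moreover have "poly (l k) (z m) = 0" if "k \<noteq> m" using that m by (auto simp: l)
        ultimately show "poly (smult (poly p (z k) / w k) (l k)) y = (if k = m then poly p (z m) else 0)"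
          using m by (auto simp: l w_def)
      qed simp
      then show ?thesis using m by simp
    qed
  qed
  then have "poly p x = poly q x" by (rule arg_cong)
  also have "\<dots> = (\<Sum>k\<le>n. poly p (z k) / w k * poly (l k) x)"
    by (simp add: q_def poly_sum)
  also have "cmod \<dots> \<le> (\<Sum>k\<le>n. ((1 + R) / \<delta>) ^ n * M)"
  proof (rule sum_norm_le)
    fix k assume "k \<in> {..n}"
    then have k: "k \<le> n" by simp
    have R0: "0 \<le> R" using order_trans[OF norm_ge_zero node(1)[OF k]] .
    have M0: "0 \<le> M" using order_trans[OF norm_ge_zero node(2)[OF k]] .
    have "poly p (z k) / w k * poly (l k) x = poly p (z k) * (\<Prod>j\<in>{..n} - {k}. (x - z j) / (z k - z j))"
      by (simp add: l w_def prod_dividef)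
    also have "cmod \<dots> = cmod (poly p (z k)) * (\<Prod>j\<in>{..n} - {k}. cmod ((x - z j) / (z k - z j)))"
      by (simp add: norm_mult prod_norm)
    also have "\<dots> \<le> M * (\<Prod>j\<in>{..n} - {k}. (1 + R) / \<delta>)"
    proof (intro mult_mono prod_mono conjI node(2) k)
      fix j assume j: "j \<in> {..n} - {k}"
      have "cmod (x - z j) \<le> 1 + R"
        using norm_triangle_ineq4[of x "z j"] x node(1)[of j] j by simp
      then show "cmod ((x - z j) / (z k - z j)) \<le> (1 + R) / \<delta>"
        unfolding norm_divide using sep[of k j] j k \<delta> R0 by (intro frac_le) auto
    qed (auto intro!: prod_nonneg M0)
    also have "\<dots> = ((1 + R) / \<delta>) ^ n * M"
      using k by simp
    finally show "cmod (poly p (z k) / w k * poly (l k) x) \<le> ((1 + R) / \<delta>) ^ n * M" .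
  qed
  also have "\<dots> = (real n + 1) * (((1 + R) / \<delta>) ^ n * M)" by (simp add: algebra_simps)
  finally show ?thesis .
qed

section \<open>Exponential polynomials: coefficient bound and growth\<close>

text \<open>Exponents range over the full square rather than \<open>i + j \<le> n\<close>, and
  coefficients are an arbitrary array. The two variables can then be treated separately, and no
  degree condition has to be maintained.\<close>

definition expoly :: "complex poly \<Rightarrow> nat \<Rightarrow> (nat \<Rightarrow> nat \<Rightarrow> complex) \<Rightarrow> complex \<Rightarrow> complex" where
  "expoly t n c z = (\<Sum>i\<le>n. \<Sum>j\<le>n. c i j * z ^ i * exp (poly t z) ^ j)"

lemma holomorphic_expoly: "expoly t n c holomorphic_on S"
  unfolding expoly_def[abs_def] by (intro holomorphic_intros)

text \<open>
  For \<open>\<bar>y\<bar> = 1\<close> and \<open>y = e\<^sup>s\<close>, the values of \<open>P(\<cdot>, y)\<close> at \<open>n + 1\<close> points \<open>z\<^sub>k\<close> with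
  \<open>t(z\<^sub>k) = s + 2\<pi>ik\<close> are the values \<open>F(z\<^sub>k)\<close>. Lagrange interpolation at these nodes recovers \<open>P(\<cdot>, y)\<close>.
\<close>
lemma expoly_coeff_bound:
  assumes t: "0 < degree t" and r: "0 \<le> r"
  obtains K G :: real where "1 \<le> K" "r ^ degree t \<le> K" "1 \<le> G"
    "\<And>n R c X i j. 1 \<le> n \<Longrightarrow> R ^ degree t = K * real n \<Longrightarrow> 1 \<le> R \<Longrightarrow>
      (\<And>z. cmod z \<le> R \<Longrightarrow> cmod (expoly t n c z) \<le> X) \<Longrightarrow> i \<le> n \<Longrightarrow> j \<le> n \<Longrightarrow>
      cmod (c i j) \<le> (real n + 1) * ((G * real n ^ 2) ^ n * X)"
proof -
  define d where "d = degree t"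
  obtain Kd where Kd: "1 \<le> Kd"
    "\<And>m R z. degree (pderiv t) \<le> m \<Longrightarrow> 1 \<le> R \<Longrightarrow> cmod z \<le> R \<Longrightarrow> cmod (poly (pderiv t) z) \<le> Kd * R ^ m"
    by (rule poly_norm_le[of "pderiv t"]) blast
  obtain Kg where Kg: "1 \<le> Kg" "\<And>z. cmod z ^ d \<le> Kg * (1 + cmod (poly t z))"
    using poly_norm_ge[OF t] unfolding d_def by blast
  \<comment> \<open>The 13 comes from \<open>1 + cmod (s k) \<le> 5 + 8 n \<le> 13 n\<close>, which
    places all nodes in the disc of radius \<open>R\<close>. The summand \<open>r ^ d\<close> later
    ensures \<open>r \<le> R\<close>.\<close>
  define K where "K = 13 * Kg + r ^ d"
  have K: "1 \<le> K" "r ^ d \<le> K" "13 * Kg \<le> K"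
    using Kg r zero_le_power[OF r, of d] unfolding K_def by linarith+
  \<comment> \<open>Here \<open>1 + R \<le> 2 K n\<close>, and the reciprocal of the node separation
    is \<open>Kd * K * n\<close>; \<open>G n^2\<close> bounds their product.\<close>
  define G where "G = 2 * K * (Kd * K)"
  have "1 * 1 \<le> Kd * K" using Kd K by (intro mult_mono) auto
  then have "1 * 1 \<le> 2 * K * (Kd * K)" using K by (intro mult_mono) auto
  then have G: "1 \<le> G" by (simp add: G_def)
  have "cmod (c i j) \<le> (real n + 1) * ((G * real n ^ 2) ^ n * X)"
    if n: "1 \<le> n" and Rd: "R ^ d = K * real n" and R: "1 \<le> R"
      and X: "\<And>z. cmod z \<le> R \<Longrightarrow> cmod (expoly t n c z) \<le> X" and i: "i \<le> n" and j: "j \<le> n"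
    for n R c X i j
  proof -
    have X0: "0 \<le> X" using order_trans[OF norm_ge_zero X[of 0]] R by simp
    have RK: "R \<le> K * real n" using self_le_power[OF R, of d] t Rd by (simp add: d_def)
    have Kn: "1 \<le> K * real n" using K n mult_mono[of 1 K 1 "real n"] by simp
    define A where "A = (real n + 1) * ((G * real n ^ 2) ^ n * X)"
    define p where "p y = (\<Sum>i\<le>n. monom (\<Sum>j\<le>n. c i j * y ^ j) i)" for y
    have degp: "degree (p y) \<le> n" for y
      unfolding p_def by (rule degree_sum_le) (auto intro: order_trans[OF degree_monom_le])
    have pF: "poly (p (exp (poly t z))) z = expoly t n c z" for z
      by (simp add: p_def expoly_def poly_sum poly_monom sum_distrib_left mult_ac)
    have "cmod (poly (p y) x) \<le> A" if y: "cmod y = 1" and x: "cmod x \<le> 1" for x y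
    proof -
      define s where "s k = \<i> * of_real (Arg y + 2 * pi * real k)" for k :: nat
      have exp_s: "exp (s k) = y" for k
      proof -
        have "y \<noteq> 0" using y by auto
        then have "exp (\<i> * of_real (Arg y)) = y" using Arg_eq[of y] y by simp
        moreover have "s k = \<i> * of_real (Arg y) + of_real (2 * real k * pi) * \<i>"
          by (simp add: s_def algebra_simps)
        moreover have "exp (of_real (2 * real k * pi) * \<i>) = 1"
          by (auto simp: exp_eq_1 intro!: exI[of _ "int k"])
        ultimately show ?thesis by (simp add: exp_add)
      qed
      have "\<exists>z. poly t z = s k" for k
      proof -
        have "degree (t - [:s k:]) = degree t"
          unfolding diff_conv_add_uminus using t by (intro degree_add_eq_left) simp
        then show ?thesis using alg_closed_imp_poly_has_root[of "t - [:s k:]"] t by auto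
      qed
      then obtain z where z: "\<And>k. poly t (z k) = s k" by metis
      have zR: "cmod (z k) \<le> R" if k: "k \<le> n" for k
      proof (rule power_le_imp_le_base)
        have "cmod (s k) \<le> \<bar>Arg y\<bar> + 2 * pi * real k"
          using abs_triangle_ineq[of "Arg y" "2 * pi * real k"] by (simp add: s_def norm_mult del: of_real_add of_real_mult)
        also have "\<dots> \<le> 4 + 8 * real n"
        proof -
          have "\<bar>Arg y\<bar> \<le> pi" using Arg_bounded[of y] by auto
          moreover have "2 * pi * real k \<le> 8 * real n"
            using k pi_less_4 by (intro mult_mono) auto
          ultimately show ?thesis using pi_less_4 by linarith
        qed
        finally have "1 + cmod (s k) \<le> 13 * real n" using n by simp
        then have "Kg * (1 + cmod (s k)) \<le> Kg * (13 * real n)" using Kg by (intro mult_left_mono) auto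
        also have "\<dots> \<le> R ^ d"
          using K(3) n mult_right_mono[of "13 * Kg" K "real n"] by (simp add: Rd mult_ac)
        also have "R ^ d = R ^ Suc (d - 1)" using t by (simp add: d_def)
        finally show "cmod (z k) ^ Suc (d - 1) \<le> R ^ Suc (d - 1)"
          using Kg(2)[of "z k"] t by (simp add: z d_def)
      qed (use R in auto)
      \<comment> \<open>The values of \<open>t\<close> at two nodes differ by a nonzero multiple of
        \<open>2 pi i\<close>, hence by at least 1 in modulus, while the derivative of
        \<open>t\<close> on the disc is at most \<open>Kd * R ^ d\<close>.\<close>
      have sep: "1 / (Kd * (K * real n)) \<le> cmod (z k - z m)" if "k \<le> n" "m \<le> n" "k \<noteq> m" for k m
      proof -
        have "cmod (poly t (z k) - poly t (z m)) \<le> Kd * R ^ d * cmod (z k - z m)"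
        proof (rule field_differentiable_bound[of "cball 0 R"])
          show "(poly t has_field_derivative poly (pderiv t) y) (at y within cball 0 R)" for y
            by (rule has_field_derivative_at_within[OF poly_DERIV])
          show "cmod (poly (pderiv t) y) \<le> Kd * R ^ d" if "y \<in> cball 0 R" for y
            using that R by (intro Kd(2)) (auto simp: degree_pderiv d_def)
        qed (use zR that in auto)
        moreover have "1 \<le> cmod (poly t (z k) - poly t (z m))"
        proof -
          have "poly t (z k) - poly t (z m) = \<i> * of_real (2 * pi * real_of_int (int k - int m))"
            by (simp add: z s_def algebra_simps)
          then have "cmod (poly t (z k) - poly t (z m)) = 2 * pi * real_of_int \<bar>int k - int m\<bar>"
            by (simp add: norm_mult abs_mult del: of_real_mult)
          also have "1 * 1 \<le> \<dots>"
            using that pi_ge_two by (intro mult_mono) auto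
          finally show ?thesis by simp
        qed
        moreover have "0 < Kd * (K * real n)" using Kd Kn by simp
        ultimately show ?thesis by (simp add: Rd field_simps)
      qed
      have "cmod (poly (p y) x) \<le> (real n + 1) * (((1 + R) / (1 / (Kd * (K * real n)))) ^ n * X)"
      proof (rule lagrange_bound[OF degp _ sep zR _ x])
        show "0 < 1 / (Kd * (K * real n))" using Kd Kn by simp
        show "cmod (poly (p y) (z k)) \<le> X" if "k \<le> n" for k
          using pF[of "z k"] X[OF zR[OF that]] by (simp add: z exp_s)
      qed
      also have "\<dots> \<le> A"
        unfolding A_def
      proof (intro mult_left_mono mult_right_mono power_mono X0)
        have "(1 + R) * (Kd * (K * real n)) \<le> (2 * (K * real n)) * (Kd * (K * real n))"
          using RK Kn Kd by (intro mult_right_mono) auto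
        then show "(1 + R) / (1 / (Kd * (K * real n))) \<le> G * (real n)\<^sup>2"
          by (simp add: G_def power2_eq_square mult_ac)
      qed (use R Kd Kn in auto)
      finally show ?thesis .
    qed
    \<comment> \<open>Two Cauchy estimates on unit circles follow: first in \<open>x\<close> for
      each fixed \<open>y\<close> of modulus 1, then in \<open>y\<close> for the coefficient of
      \<open>x^i\<close>.\<close>
    then have 1: "cmod (coeff (p y) i) \<le> A" if "cmod y = 1" for y
      using poly_coeff_bound[of 1 "p y" A i] that by simp
    define u where "u = (\<Sum>j\<le>n. monom (c i j) j)"
    have "coeff (p y) i = poly u y" for y
      using i by (simp add: p_def u_def coeff_sum poly_sum poly_monom)
    then have "cmod (coeff u j) \<le> A" using poly_coeff_bound[of 1 u A j] 1 by simp
    then show ?thesis using j by (simp add: u_def coeff_sum A_def)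
  qed
  then show thesis using that K G unfolding d_def by blast
qed

text \<open>With \<open>X\<close> the maximum on radius \<open>R\<close>, the coefficients are at
  most \<open>e^(O(n log n)) X\<close>. On radius \<open>B R\<close> the powers of \<open>z\<close>
  are at most \<open>(B K n) ^ n\<close>, and those of \<open>exp (poly t z)\<close> at most
  \<open>e^(O(n^2))\<close>, since \<open>t\<close> is of size \<open>O(n)\<close> there.\<close>

lemma expoly_doubling:
  assumes t: "0 < degree t" and r: "0 \<le> r" and B: "1 \<le> B"
  obtains D :: real where "1 \<le> D"
    "\<And>n. 1 \<le> n \<Longrightarrow> \<exists>R\<ge>r. \<forall>c. \<exists>X. (\<exists>z. cmod z \<le> R \<and> cmod (expoly t n c z) = X) \<and>
      (\<forall>z. cmod z \<le> B * R \<longrightarrow> cmod (expoly t n c z) \<le> D ^ (n\<^sup>2) * X)"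
proof -
  define d where "d = degree t"
  obtain K G where K: "1 \<le> K" "r ^ d \<le> K" and G: "1 \<le> G" and cb:
    "\<And>n R c X i j. 1 \<le> n \<Longrightarrow> R ^ d = K * real n \<Longrightarrow> 1 \<le> R \<Longrightarrow>
      (\<And>z. cmod z \<le> R \<Longrightarrow> cmod (expoly t n c z) \<le> X) \<Longrightarrow> i \<le> n \<Longrightarrow> j \<le> n \<Longrightarrow>
      cmod (c i j) \<le> (real n + 1) * ((G * real n ^ 2) ^ n * X)"
    by (fact expoly_coeff_bound[OF t r, folded d_def])
  obtain Kt where Kt: "1 \<le> Kt"
    "\<And>m R z. degree t \<le> m \<Longrightarrow> 1 \<le> R \<Longrightarrow> cmod z \<le> R \<Longrightarrow> cmod (poly t z) \<le> Kt * R ^ m"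
    by (rule poly_norm_le[of t]) blast
  define Q where "Q = exp (Kt * B ^ d * K)"
  have Q: "1 \<le> Q" using Kt B K by (simp add: Q_def)
  \<comment> \<open>The four factors absorb, in order, \<open>(n + 1) ^ 3\<close>, the coefficient
    bound, the powers of \<open>z\<close> and the powers of the exponential.\<close>
  define D where "D = 8 * (4 * G) * (2 * (B * K)) * Q"
  have BK: "1 \<le> B * K" using B K mult_mono[of 1 B 1 K] by simp
  have D: "1 \<le> D"
  proof -
    have "1 * 1 * 1 * 1 \<le> D" unfolding D_def using G BK Q by (intro mult_mono) auto
    then show ?thesis by simp
  qed
  have "\<exists>R\<ge>r. \<forall>c. \<exists>X. (\<exists>z. cmod z \<le> R \<and> cmod (expoly t n c z) = X) \<and>
      (\<forall>z. cmod z \<le> B * R \<longrightarrow> cmod (expoly t n c z) \<le> D ^ (n\<^sup>2) * X)" if n: "1 \<le> n" for n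
  proof -
    define R where "R = root d (K * real n)"
    have Kn: "1 \<le> K * real n" "K \<le> K * real n"
      using K n mult_mono[of 1 K 1 "real n"] mult_left_mono[of 1 "real n" K] by auto
    have Rd: "R ^ d = K * real n" unfolding R_def using t Kn by (simp add: d_def)
    have R1: "1 \<le> R" unfolding R_def using t Kn by (simp add: d_def)
    have "r ^ Suc (d - 1) \<le> R ^ Suc (d - 1)" using Rd K(2) Kn(2) t by (simp add: d_def)
    then have rR: "r \<le> R" by (rule power_le_imp_le_base) (use R1 in simp)
    have RK: "R \<le> K * real n" using self_le_power[OF R1, of d] t Rd by (simp add: d_def)
    have BR: "1 \<le> B * R" using B R1 mult_mono[of 1 B 1 R] by simp
    have "\<exists>X. (\<exists>z. cmod z \<le> R \<and> cmod (expoly t n c z) = X) \<and>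
      (\<forall>z. cmod z \<le> B * R \<longrightarrow> cmod (expoly t n c z) \<le> D ^ (n\<^sup>2) * X)" for c
    proof -
      have "continuous_on (cball 0 R) (\<lambda>z. cmod (expoly t n c z))"
        by (intro continuous_on_norm holomorphic_on_imp_continuous_on holomorphic_expoly)
      then obtain z0 where z0: "cmod z0 \<le> R"
        and max: "\<And>z. cmod z \<le> R \<Longrightarrow> cmod (expoly t n c z) \<le> cmod (expoly t n c z0)"
        using continuous_attains_sup[of "cball 0 R" "\<lambda>z. cmod (expoly t n c z)"] R1 by auto
      define X where "X = cmod (expoly t n c z0)"
      have X0: "0 \<le> X" by (simp add: X_def)
      have cX: "cmod (c i j) \<le> (real n + 1) * ((G * real n ^ 2) ^ n * X)" if "i \<le> n" "j \<le> n" for i j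
        by (rule cb[OF n Rd R1 _ that]) (use max in \<open>simp add: X_def\<close>)
      have "cmod (expoly t n c z) \<le> D ^ (n\<^sup>2) * X" if z: "cmod z \<le> B * R" for z
      proof -
        have "cmod (poly t z) \<le> Kt * (B * R) ^ d"
          by (rule Kt(2)) (use BR z in \<open>auto simp: d_def\<close>)
        also have "\<dots> = Kt * B ^ d * K * real n" by (simp add: power_mult_distrib Rd)
        finally have "exp (cmod (poly t z)) \<le> Q ^ n"
          by (simp add: Q_def mult_ac flip: exp_of_nat_mult)
        then have eQ: "cmod (exp (poly t z)) \<le> Q ^ n" using norm_exp[of "poly t z"] by linarith
        have "cmod (expoly t n c z) \<le> (\<Sum>i\<le>n. \<Sum>j\<le>n.
            (real n + 1) * ((G * real n ^ 2) ^ n * X) * (B * K * real n) ^ n * (Q ^ n) ^ n)"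
          unfolding expoly_def
        proof (intro sum_norm_le)
          fix i j assume ij: "i \<in> {..n}" "j \<in> {..n}"
          have "cmod z ^ i \<le> (B * R) ^ i" using z by (intro power_mono) auto
          also have "\<dots> \<le> (B * R) ^ n" using BR ij by (intro power_increasing) auto
          also have "\<dots> \<le> (B * K * real n) ^ n"
            using B RK R1 mult_left_mono[OF RK, of B] by (intro power_mono) (auto simp: mult_ac)
          finally have zi: "cmod z ^ i \<le> (B * K * real n) ^ n" .
          have "cmod (exp (poly t z)) ^ j \<le> (Q ^ n) ^ j" using eQ by (intro power_mono) auto
          also have "\<dots> \<le> (Q ^ n) ^ n" using Q ij by (intro power_increasing) (auto simp: one_le_power)
          finally have ej: "cmod (exp (poly t z)) ^ j \<le> (Q ^ n) ^ n" .
          show "cmod (c i j * z ^ i * exp (poly t z) ^ j)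
              \<le> (real n + 1) * ((G * real n ^ 2) ^ n * X) * (B * K * real n) ^ n * (Q ^ n) ^ n"
            unfolding norm_mult norm_power
            using cX zi ej ij BK G X0 by (intro mult_mono) auto
        qed
        \<comment> \<open>Two factors \<open>n + 1\<close> count the terms of the double sum, the
          third comes from the interpolation bound.\<close>
        also have "\<dots> = (real n + 1) ^ 3 * (G * real n ^ 2) ^ n * (B * K * real n) ^ n * (Q ^ n) ^ n * X"
          unfolding sum_constant card_atMost of_nat_Suc power3_eq_cube by (simp only: mult_ac add.commute)
        also have "\<dots> \<le> (2 ^ n) ^ 3 * ((4 * G) ^ n) ^ n * ((2 * (B * K)) ^ n) ^ n * (Q ^ n) ^ n * X"
        proof (intro mult_right_mono mult_mono power_mono X0)
          have n2: "real n + 1 \<le> 2 ^ n"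
            using of_nat_mono[OF Suc_leI[OF less_exp[of n]], where 'a = real] by simp
          then show "real n + 1 \<le> 2 ^ n" .
          have G': "G \<le> G ^ n" and BK': "B * K \<le> (B * K) ^ n"
            using self_le_power[OF G] self_le_power[OF BK] n by auto
          have "real n ^ 2 \<le> (2 ^ n) ^ 2" by (rule power_mono) (use n2 in linarith, simp)
          with G' have "G * real n ^ 2 \<le> G ^ n * (2 ^ n) ^ 2" by (rule mult_mono) (use G in auto)
          also have "\<dots> = G ^ n * (2 ^ 2) ^ n" by (metis power_mult mult.commute)
          also have "\<dots> = (4 * G) ^ n" by (simp add: power_mult_distrib)
          finally show "G * real n ^ 2 \<le> (4 * G) ^ n" .
          have "real n \<le> 2 ^ n" using n2 by linarith
          with BK' have "B * K * real n \<le> (B * K) ^ n * 2 ^ n" by (rule mult_mono) (use BK in auto)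
          also have "\<dots> = (2 * (B * K)) ^ n" by (simp only: power_mult_distrib mult.commute)
          finally show "B * K * real n \<le> (2 * (B * K)) ^ n" .
        qed (use G BK Q in auto)
        also have "(2 ^ n) ^ 3 = ((2 :: real) ^ 3) ^ n" by (metis power_mult mult.commute)
        also have "(2 :: real) ^ 3 = 8" by simp
        also have "8 ^ n * ((4 * G) ^ n) ^ n * ((2 * (B * K)) ^ n) ^ n * (Q ^ n) ^ n * X
            \<le> (8 ^ n) ^ n * ((4 * G) ^ n) ^ n * ((2 * (B * K)) ^ n) ^ n * (Q ^ n) ^ n * X"
          using n G BK Q X0 by (intro mult_right_mono self_le_power) (auto simp: one_le_power)
        also have "\<dots> = D ^ (n\<^sup>2) * X"
          unfolding power2_eq_square power_mult D_def power_mult_distrib ..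
        finally show ?thesis .
      qed
      then show ?thesis using z0 unfolding X_def by blast
    qed
    then show ?thesis using rR by blast
  qed
  then show thesis using that D by blast
qed

section \<open>The Markov inequality for exponential polynomials\<close>

lemma expoly_markov_nonconstant:
  fixes a b :: real
  assumes ab: "a < b" and t: "0 < degree t"
  shows "\<exists>C :: real. \<forall>n c E. (\<forall>x\<in>{a..b}. cmod (expoly t n c (of_real x)) \<le> E) \<longrightarrow>
    (\<forall>x\<in>{a..b}. cmod (deriv (expoly t n c) (of_real x)) \<le> C * real n ^ 4 * E)"
proof -
  obtain B r where B: "2 \<le> B" and r: "0 < r" and main:
    "\<And>D. 1 \<le> D \<Longrightarrow> \<exists>C. \<forall>F n R X E x. F holomorphic_on UNIV \<longrightarrow> 1 \<le> n \<longrightarrow> r \<le> R \<longrightarrow>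
      (\<forall>z. cmod z \<le> B * R \<longrightarrow> cmod (F z) \<le> D ^ (n\<^sup>2) * X) \<longrightarrow>
      (\<exists>z. cmod z \<le> R \<and> cmod (F z) = X) \<longrightarrow>
      (\<forall>x\<in>{a..b}. cmod (F (of_real x)) \<le> E) \<longrightarrow> x \<in> {a..b} \<longrightarrow>
      cmod (deriv F (of_real x)) \<le> C * real n ^ 4 * E"
    by (fact deriv_bound_of_doubling[OF ab])
  obtain D where D: "1 \<le> D" and doubling:
    "\<And>n. 1 \<le> n \<Longrightarrow> \<exists>R\<ge>r. \<forall>c. \<exists>X. (\<exists>z. cmod z \<le> R \<and> cmod (expoly t n c z) = X) \<and>
      (\<forall>z. cmod z \<le> B * R \<longrightarrow> cmod (expoly t n c z) \<le> D ^ (n\<^sup>2) * X)"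
    using expoly_doubling[OF t less_imp_le[OF r], of B] B by auto
  obtain C where bound:
    "\<And>F n R X E x. F holomorphic_on UNIV \<Longrightarrow> 1 \<le> n \<Longrightarrow> r \<le> R \<Longrightarrow>
      (\<forall>z. cmod z \<le> B * R \<longrightarrow> cmod (F z) \<le> D ^ (n\<^sup>2) * X) \<Longrightarrow>
      (\<exists>z. cmod z \<le> R \<and> cmod (F z) = X) \<Longrightarrow>
      (\<forall>x\<in>{a..b}. cmod (F (of_real x)) \<le> E) \<Longrightarrow> x \<in> {a..b} \<Longrightarrow>
      cmod (deriv F (of_real x)) \<le> C * real n ^ 4 * E"
    using main[OF D] by blast
  have "cmod (deriv (expoly t n c) (of_real x)) \<le> C * real n ^ 4 * E"
    if E: "\<forall>x\<in>{a..b}. cmod (expoly t n c (of_real x)) \<le> E" and x: "x \<in> {a..b}" for n c E x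
  proof (cases "n = 0")
    case True
    \<comment> \<open>The growth estimate starts at \<open>n = 1\<close>; for \<open>n = 0\<close>
      the function is constant and both sides vanish.\<close>
    then have "expoly t n c = (\<lambda>_. c 0 0)" by (auto simp: expoly_def)
    then show ?thesis using True by simp
  next
    case False
    then have n: "1 \<le> n" by simp
    obtain R X where R: "r \<le> R" and X: "\<exists>z. cmod z \<le> R \<and> cmod (expoly t n c z) = X"
      "\<forall>z. cmod z \<le> B * R \<longrightarrow> cmod (expoly t n c z) \<le> D ^ (n\<^sup>2) * X"
      using doubling[OF n] by blast
    show ?thesis
      by (rule bound[OF holomorphic_expoly n R X(2) X(1) E x])
  qed
  then show ?thesis by blast
qed

text \<open>If \<open>t\<close> is a constant \<open>w\<close>, the powers of \<open>exp w\<close>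
  are absorbed into the coefficients. The result is a polynomial in \<open>z\<close> alone, which is
  also an exponential polynomial for \<open>t(z) = z\<close> with only the terms
  \<open>j = 0\<close>.\<close>

lemma expoly_markov:
  fixes a b :: real
  assumes ab: "a < b"
  shows "\<exists>C :: real. \<forall>n c E. (\<forall>x\<in>{a..b}. cmod (expoly t n c (of_real x)) \<le> E) \<longrightarrow>
    (\<forall>x\<in>{a..b}. cmod (deriv (expoly t n c) (of_real x)) \<le> C * real n ^ 4 * E)"
proof (cases "degree t = 0")
  case False
  then show ?thesis using expoly_markov_nonconstant[OF ab, of t] by simp
next
  case True
  then obtain w where t: "t = [:w:]" by (rule degree_eq_zeroE)
  define c' where "c' n c i j = (if j = 0 then \<Sum>k\<le>n. c i k * exp w ^ k else 0)"
    for n :: nat and c :: "nat \<Rightarrow> nat \<Rightarrow> complex" and i j :: nat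
  have "expoly t n c = expoly [:0, 1:] n (c' n c)" for n c
  proof
    fix z
    have "(\<Sum>j\<le>n. c' n c i j * z ^ i * exp z ^ j) = (\<Sum>j\<le>n. c i j * z ^ i * exp w ^ j)" for i
    proof -
      have "(\<Sum>j\<le>n. c' n c i j * z ^ i * exp z ^ j)
          = (\<Sum>j\<le>n. if j = 0 then (\<Sum>k\<le>n. c i k * exp w ^ k) * z ^ i else 0)"
        by (rule sum.cong) (auto simp: c'_def)
      then show ?thesis by (simp add: sum_distrib_left mult_ac)
    qed
    then show "expoly t n c z = expoly [:0, 1:] n (c' n c) z"
      by (simp add: expoly_def t)
  qed
  moreover have "\<exists>C :: real. \<forall>n c E. (\<forall>x\<in>{a..b}. cmod (expoly [:0, 1:] n c (of_real x)) \<le> E) \<longrightarrow>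
    (\<forall>x\<in>{a..b}. cmod (deriv (expoly [:0, 1:] n c) (of_real x)) \<le> C * real n ^ 4 * E)"
    by (rule expoly_markov_nonconstant[OF ab]) simp
  ultimately show ?thesis by metis
qed

section \<open>Return to real bivariate polynomials\<close>

lemma total_degree_ge:
  assumes "coeff (coeff P j) i \<noteq> 0"
  shows "i + j \<le> total_degree P"
  unfolding total_degree_def using assms finite_total_degrees[of P] by (intro Max_ge) auto

text \<open>Padding with zero coefficients up to the total degree in both exponents gives the square
  shape of \<open>expoly\<close>.\<close>

lemma eval2_eq_sum_total_degree:
  assumes n: "n = total_degree P"
  shows "eval2 P x y = (\<Sum>i\<le>n. \<Sum>j\<le>n. coeff (coeff P j) i * x ^ i * y ^ j)"
proof -
  have d1: "degree (coeff P j) \<le> n" for j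
  proof (cases "coeff P j = 0")
    case False
    then show ?thesis using total_degree_ge[of P j "degree (coeff P j)"] n by simp
  qed simp
  have d2: "degree P \<le> n"
  proof (cases "P = 0")
    case False
    then have "coeff (lead_coeff P) (degree (lead_coeff P)) \<noteq> 0" by simp
    then show ?thesis using total_degree_ge[of P "degree P"] n by (meson add_leE)
  qed simp
  have "eval2 P x y = (\<Sum>j\<le>n. \<Sum>i\<le>n. coeff (coeff P j) i * x ^ i * y ^ j)"
    unfolding eval2_def poly_altdef_le[OF d2]
    by (simp add: poly_sum poly_altdef_le[OF d1] sum_distrib_left sum_distrib_right mult_ac flip: pCons_one)
  then show ?thesis by (subst sum.swap)
qed

theorem theorem1p2:
  fixes t :: "real poly"
  shows "\<forall>a b :: real. a < b \<longrightarrow>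
    (\<exists>C :: real. \<forall>P :: real poly poly.
      (SUP x\<in>{a..b}. \<bar>deriv (\<lambda>s. eval2 P s (exp (poly t s))) x\<bar>)
        \<le> C * real (total_degree P) ^ 4 * (SUP x\<in>{a..b}. \<bar>eval2 P x (exp (poly t x))\<bar>))"
proof (intro allI impI)
  fix a b :: real
  assume ab: "a < b"
  define T where "T = map_poly complex_of_real t"
  obtain C where C: "\<forall>n c E. (\<forall>x\<in>{a..b}. cmod (expoly T n c (of_real x)) \<le> E) \<longrightarrow>
      (\<forall>x\<in>{a..b}. cmod (deriv (expoly T n c) (of_real x)) \<le> C * real n ^ 4 * E)"
    using expoly_markov[OF ab, of T] by (rule exE)
  have "(SUP x\<in>{a..b}. \<bar>deriv (\<lambda>s. eval2 P s (exp (poly t s))) x\<bar>)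
        \<le> C * real (total_degree P) ^ 4 * (SUP x\<in>{a..b}. \<bar>eval2 P x (exp (poly t x))\<bar>)" for P
  proof -
    define f where "f s = eval2 P s (exp (poly t s))" for s
    define F where "F = expoly T (total_degree P) (\<lambda>i j. of_real (coeff (coeff P j) i))"
    define E where "E = (SUP x\<in>{a..b}. \<bar>f x\<bar>)"
    have T: "poly T (of_real x) = of_real (poly t x)" for x
      unfolding T_def by (induction t) (simp_all add: map_poly_pCons)
    have Ff: "F (of_real x) = of_real (f x)" for x
      unfolding f_def eval2_eq_sum_total_degree[OF refl]
      by (simp add: F_def expoly_def T flip: exp_of_real)
    have cont: "continuous_on {a..b} f" "continuous_on {a..b} (deriv f)"
      unfolding f_def[abs_def] by (rule continuous_on_eval2_exp continuous_on_deriv_eval2_exp)+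
    \<comment> \<open>The supremum of the derivative is attained, so a bound at the single point
      \<open>x0\<close> suffices.\<close>
    obtain x0 where x0: "x0 \<in> {a..b}" "\<bar>deriv f x0\<bar> = (SUP x\<in>{a..b}. \<bar>deriv f x\<bar>)"
      using abs_SUP_attained[OF less_imp_le[OF ab] cont(2)] by blast
    have E: "\<bar>f x\<bar> \<le> E" if "x \<in> {a..b}" for x
      using abs_SUP_attained[OF less_imp_le[OF ab] cont(1)] that unfolding E_def by force
    \<comment> \<open>Both sides are the derivative at \<open>x0\<close> of the restriction of
      \<open>F\<close> to the real line, one by the chain rule and one because this restriction is
      \<open>f\<close>.\<close>
    have "deriv F (of_real x0) = of_real (deriv f x0)"
    proof (rule vector_derivative_unique_at)
      have "(F has_field_derivative deriv F (of_real x0)) (at (of_real x0))"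
        unfolding F_def by (rule holomorphic_derivI[OF holomorphic_expoly[of _ _ _ UNIV]]) auto
      then show "((\<lambda>x. F (of_real x)) has_vector_derivative deriv F (of_real x0)) (at x0)"
        by (rule has_vector_derivative_real_field)
      have "(f has_real_derivative deriv f x0) (at x0)"
        unfolding f_def[abs_def] DERIV_imp_deriv[OF eval2_exp_has_derivative]
        by (rule eval2_exp_has_derivative)
      then show "((\<lambda>x. F (of_real x)) has_vector_derivative of_real (deriv f x0)) (at x0)"
        unfolding Ff by (rule has_vector_derivative_of_real)
    qed
    moreover have "cmod (deriv F (of_real x0)) \<le> C * real (total_degree P) ^ 4 * E"
    proof -
      have "\<forall>x\<in>{a..b}. cmod (F (of_real x)) \<le> E" using E by (simp add: Ff)
      then show ?thesis using C x0(1) unfolding F_def by blast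
    qed
    ultimately have "\<bar>deriv f x0\<bar> \<le> C * real (total_degree P) ^ 4 * E" by simp
    then show ?thesis using x0(2) unfolding E_def f_def[abs_def] by simp
  qed
  then show "\<exists>C :: real. \<forall>P :: real poly poly.
      (SUP x\<in>{a..b}. \<bar>deriv (\<lambda>s. eval2 P s (exp (poly t s))) x\<bar>)
        \<le> C * real (total_degree P) ^ 4 * (SUP x\<in>{a..b}. \<bar>eval2 P x (exp (poly t x))\<bar>)" by blast
qed

end
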